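(* Consider the pendulum skate system $\dot\zeta=f(\zeta)$, $\zeta=(v^1,v^2,v^3,\Gamma_2,\Gamma_3)$, defined in the context. For every $Y_0\in\mathbb R$, the sliding equilibrium $\zeta_{\rm sl}=(0,0,Y_0,0,1)$ is linearly unstable (i.e. the Jacobian $Df(\zeta_{\rm sl})$ has an eigenvalue with positive real part).
   Context: Parameters: $m,l,\mathrm g,I_1,I_2,I_3>0$ (mass, distance from the blade--ice contact point to the center of mass, gravitational acceleration, principal moments of inertia), with the standing assumption $I_2>I_3$, and $\bar I_i:=I_i+ml^2$ for $i=1,2$. The pendulum skate is a rigid pendulum attached to a skate blade sliding without friction on a horizontal plane, with no side-sliding, no pitching, and permanent contact; its reduced (nonholonomic Euler--Poincar\'e) equations, in quasivelocities $v^1,v^2,v^3$ and the components $(\Gamma_2,\Gamma_3)$ of the vertical unit vector $\mathbf\Gamma=(0,\Gamma_2,\Gamma_3)$ seen from the body frame (so that $\Gamma_2^2+\Gamma_3^2=1$ for the physical system), are $\dot\zeta=f(\zeta)$ with $$f(\zeta)=\Biggl(\frac{\bigl((\bar I_2-I_3)\Gamma_3(v^2)^2+m\mathrm g l\bigr)\Gamma_2+ml\,\Gamma_3v^2v^3}{\bar I_1},\ \frac{2(I_3-I_2)\Gamma_2\Gamma_3v^1v^2}{I_2\Gamma_2^2+I_3\Gamma_3^2},\ -\frac{2lI_3\Gamma_3v^1v^2}{I_2\Gamma_2^2+I_3\Gamma_3^2},\ v^1\Gamma_3,\ -v^1\Gamma_2\Biggr).$$ Superscripts on $v$ are indices; $(v^2)^2$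 is the square of $v^2$. *)

theory Defs
  imports "HOL-Analysis.Analysis"
begin

(* The state is zeta = (v^1, v^2, v^3, Gamma_2, Gamma_3), all five coordinates being independent:
   the constraint Gamma_2^2 + Gamma_3^2 = 1 is not imposed.  J1 and J2 are the barred moments
   of inertia.  Numeral indices of type 5 are residues, so that z $ 5 is the same as z $ 0. *)
definition skate_field ::
  "real \<Rightarrow> real \<Rightarrow> real \<Rightarrow> real \<Rightarrow> real \<Rightarrow> real \<Rightarrow> real ^ 5 \<Rightarrow> real ^ 5"
where
  "skate_field m l g I1 I2 I3 z =
    (let J1 = I1 + m * l\<^sup>2; J2 = I2 + m * l\<^sup>2;
         v1 = z $ 1; v2 = z $ 2; v3 = z $ 3; \<Gamma>2 = z $ 4; \<Gamma>3 = z $ 5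
     in vector
       [(((J2 - I3) * \<Gamma>3 * v2\<^sup>2 + m * g * l) * \<Gamma>2 + m * l * \<Gamma>3 * v2 * v3) / J1,
        (2 * (I3 - I2) * \<Gamma>2 * \<Gamma>3 * v1 * v2) / (I2 * \<Gamma>2\<^sup>2 + I3 * \<Gamma>3\<^sup>2),
        - ((2 * l * I3 * \<Gamma>3 * v1 * v2) / (I2 * \<Gamma>2\<^sup>2 + I3 * \<Gamma>3\<^sup>2)),
        v1 * \<Gamma>3,
        - (v1 * \<Gamma>2)])"

definition sliding_equilibrium :: "real \<Rightarrow> real ^ 5" where
  "sliding_equilibrium Y0 = vector [0, 0, Y0, 0, 1]"

definition matrix_eigenvalue :: "'a::field ^ 'n ^ 'n \<Rightarrow> 'a \<Rightarrow> bool" where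
  "matrix_eigenvalue A k \<longleftrightarrow> (\<exists>v. v \<noteq> 0 \<and> A *v v = k *s v)"

(* Differentiability is required because jacobian is an unspecified matrix at points where
   the function is not differentiable. *)
definition linearly_unstable :: "(real ^ 'n \<Rightarrow> real ^ 'n) \<Rightarrow> real ^ 'n \<Rightarrow> bool" where
  "linearly_unstable F x \<longleftrightarrow>
     F differentiable (at x) \<and>
     (\<exists>k. matrix_eigenvalue (map_matrix complex_of_real (jacobian F (at x))) k \<and> Re k > 0)"

lemma UNIV_5: "(UNIV :: 5 set) = {1, 2, 3, 4, 5}"
proof -
  have "z \<in> {1, 2, 3, 4, 5}" for z :: 5
  proof (cases z rule: bit1_cases)
    case (of_int n)
    then have "n = 0 \<or> n = 1 \<or> n = 2 \<or> n = 3 \<or> n = 4"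
      by auto
    then show ?thesis
      using of_int by auto
  qed
  then show ?thesis
    by auto
qed

lemma forall_5: "(\<forall>i::5. P i) \<longleftrightarrow> P 1 \<and> P 2 \<and> P 3 \<and> P 4 \<and> P 5"
  by (metis (full_types) UNIV_5 UNIV_I empty_iff insert_iff)

lemma vector_5 [simp]:
  "(vector [a, b, c, d, e] :: 'a::zero ^ 5) $ 1 = a"
  "(vector [a, b, c, d, e] :: 'a::zero ^ 5) $ 2 = b"
  "(vector [a, b, c, d, e] :: 'a::zero ^ 5) $ 3 = c"
  "(vector [a, b, c, d, e] :: 'a::zero ^ 5) $ 4 = d"
  "(vector [a, b, c, d, e] :: 'a::zero ^ 5) $ 5 = e"
  by (simp_all add: vector_def)

lemma skate_field_sliding_equilibrium:
  "skate_field m l g I1 I2 I3 (sliding_equilibrium Y0) = 0"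
  by (simp add: skate_field_def sliding_equilibrium_def vec_eq_iff forall_5)

end

theory Submission
  imports Defs
begin

text \<open>
  At the sliding equilibrium the linearised equations for \<open>\<Gamma>\<^sub>2\<close> and \<open>v\<^sup>1\<close> give
  \<open>\<Gamma>\<^sub>2'' = (m g l / (I\<^sub>1 + m l\<^sup>2)) \<Gamma>\<^sub>2\<close> when the perturbation of \<open>v\<^sup>2\<close> vanishes, as for
  an inverted pendulum, so the positive square root \<open>k\<close> of that coefficient is an eigenvalue, with
  eigenvector \<open>(k, 0, 0, 1, 0)\<close>.
\<close>

text \<open>Each basis vector of \<open>real ^ 'n\<close> is some \<open>axis i 1\<close>, and the
  inner product with it reads off coordinate \<open>i\<close>. This splits the field into five
  scalar derivatives.\<close>

lemma has_derivative_vec_nth_iff: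
  fixes F :: "'a::real_normed_vector \<Rightarrow> real ^ 'n"
  shows "(F has_derivative D) (at x within S) \<longleftrightarrow>
    (\<forall>i. ((\<lambda>z. F z $ i) has_derivative (\<lambda>h. D h $ i)) (at x within S))"
  by (subst has_derivative_componentwise_within) (auto simp: Basis_vec_def inner_axis)

text \<open>In components 2, 3 and 5 at least two factors among v1, v2, \<Gamma>2 vanish at the
  equilibrium, so they have no linear part.\<close>

lemma skate_field_has_derivative:
  fixes m l g I1 I2 I3 Y0 :: real
  assumes "I3 \<noteq> 0"
  shows "(skate_field m l g I1 I2 I3 has_derivative
    (\<lambda>h. vector [(m * g * l * h $ 4 + m * l * Y0 * h $ 2) / (I1 + m * l\<^sup>2), 0, 0, h $ 1, 0]))
    (at (sliding_equilibrium Y0))"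
proof -
  let ?x = "sliding_equilibrium Y0"
  note nth = bounded_linear_imp_has_derivative[OF bounded_linear_vec_nth]
  have den: "((\<lambda>z. I2 * (z $ 4)\<^sup>2 + I3 * (z $ 5)\<^sup>2) has_derivative (\<lambda>h. 2 * I3 * h $ 5)) (at ?x)"
    by (rule has_derivative_eq_rhs, (rule nth derivative_intros)+)
      (simp add: sliding_equilibrium_def fun_eq_iff)
  have "((\<lambda>z. 2 * (I3 - I2) * z $ 4 * z $ 5 * z $ 1 * z $ 2) has_derivative (\<lambda>h. 0)) (at ?x)"
    by (rule has_derivative_eq_rhs, (rule nth derivative_intros)+)
      (simp add: sliding_equilibrium_def fun_eq_iff)
  \<comment> \<open>The numerator vanishes together with its derivative, so the quotient rule gives
    0; the denominator there is \<open>I3\<close>, whence the hypothesis.\<close>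
  from has_derivative_divide'[OF this den]
  have 2: "((\<lambda>z. 2 * (I3 - I2) * z $ 4 * z $ 5 * z $ 1 * z $ 2 / (I2 * (z $ 4)\<^sup>2 + I3 * (z $ 5)\<^sup>2))
      has_derivative (\<lambda>h. 0)) (at ?x)"
    using assms by (simp add: sliding_equilibrium_def)
  have "((\<lambda>z. 2 * l * I3 * z $ 5 * z $ 1 * z $ 2) has_derivative (\<lambda>h. 0)) (at ?x)"
    by (rule has_derivative_eq_rhs, (rule nth derivative_intros)+)
      (simp add: sliding_equilibrium_def fun_eq_iff)
  from has_derivative_minus[OF has_derivative_divide'[OF this den]]
  have 3: "((\<lambda>z. - (2 * l * I3 * z $ 5 * z $ 1 * z $ 2 / (I2 * (z $ 4)\<^sup>2 + I3 * (z $ 5)\<^sup>2)))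
      has_derivative (\<lambda>h. 0)) (at ?x)"
    using assms by (simp add: sliding_equilibrium_def)
  \<comment> \<open>A constant factor \<open>inverse\<close> in place of a quotient avoids the
    condition that \<open>I1 + m * l\<^sup>2\<close> be nonzero.\<close>
  have 1: "((\<lambda>z. (((I2 + m * l\<^sup>2 - I3) * z $ 5 * (z $ 2)\<^sup>2 + m * g * l) * z $ 4
        + m * l * z $ 5 * z $ 2 * z $ 3) * inverse (I1 + m * l\<^sup>2)) has_derivative
      (\<lambda>h. (m * g * l * h $ 4 + m * l * Y0 * h $ 2) * inverse (I1 + m * l\<^sup>2))) (at ?x)"
    by (rule has_derivative_eq_rhs, (rule nth derivative_intros)+)
      (simp add: sliding_equilibrium_def fun_eq_iff mult.commute)
  have 4: "((\<lambda>z. z $ 1 * z $ 5) has_derivative (\<lambda>h. h $ 1)) (at ?x)"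
    by (rule has_derivative_eq_rhs, (rule nth derivative_intros)+)
      (simp add: sliding_equilibrium_def fun_eq_iff)
  have 5: "((\<lambda>z. - (z $ 1 * z $ 4)) has_derivative (\<lambda>h. 0)) (at ?x)"
    by (rule has_derivative_eq_rhs, (rule nth derivative_intros)+)
      (simp add: sliding_equilibrium_def fun_eq_iff)
  show ?thesis
    unfolding has_derivative_vec_nth_iff forall_5 skate_field_def Let_def vector_5
      divide_inverse[of _ "I1 + m * l\<^sup>2"]
    by (intro conjI 1 2 3 4 5)
qed

lemma sum_5: "sum f (UNIV :: 5 set) = f 1 + f 2 + f 3 + f 4 + f 5"
  unfolding UNIV_5 by (simp add: ac_simps)

text \<open>Derivatives at a point are unique, and column \<open>j\<close> of the matrix of a linear
  map is the image of \<open>axis j 1\<close>.\<close>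

lemma jacobian_nth_eq:
  fixes F :: "real ^ 'n \<Rightarrow> real ^ 'm"
  assumes "(F has_derivative D) (at x)"
  shows "jacobian F (at x) $ i $ j = D (axis j 1) $ i"
  unfolding jacobian_def matrix_def using frechet_derivative_at[OF assms] by simp

theorem proposition15:
  fixes m l g I1 I2 I3 :: real
  assumes "m > 0" and "l > 0" and "g > 0"
    and "I1 > 0" and "I2 > 0" and "I3 > 0"
    and "I2 > I3"
  shows "\<forall>Y0::real. linearly_unstable (skate_field m l g I1 I2 I3) (sliding_equilibrium Y0)"
proof
  fix Y0 :: real
  define k where "k = sqrt (m * g * l / (I1 + m * l\<^sup>2))"
  have pos: "m * g * l / (I1 + m * l\<^sup>2) > 0"
    using assms by (simp add: add_pos_pos)
  then have "k > 0"
    by (simp add: k_def)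
  have k2: "k * k = m * g * l / (I1 + m * l\<^sup>2)"
    unfolding k_def using pos by (intro real_sqrt_mult_self[THEN trans] abs_of_pos)
  have D: "(skate_field m l g I1 I2 I3 has_derivative
    (\<lambda>h. vector [(m * g * l * h $ 4 + m * l * Y0 * h $ 2) / (I1 + m * l\<^sup>2), 0, 0, h $ 1, 0]))
    (at (sliding_equilibrium Y0))"
    using assms by (intro skate_field_has_derivative) simp
  let ?A = "map_matrix complex_of_real
    (jacobian (skate_field m l g I1 I2 I3) (at (sliding_equilibrium Y0)))"
  let ?v = "vector [of_real k, 0, 0, 1, 0] :: complex ^ 5"
  have "?v \<noteq> 0"
    by (metis vector_5(4) zero_index zero_neq_one)
  \<comment> \<open>Row 1 is \<open>k2\<close> cast to the complex numbers and row 4 is trivial. The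
    zero second entry of \<open>?v\<close> removes the \<open>Y0\<close> term, so the same
    eigenvalue serves every \<open>Y0\<close>.\<close>
  moreover have "?A *v ?v = of_real k *s ?v"
    unfolding vec_eq_iff forall_5 matrix_vector_mult_def map_matrix_def sum_5 vec_lambda_beta
      vector_5 jacobian_nth_eq[OF D]
    using arg_cong[OF k2, of complex_of_real] by (simp add: axis_def)
  ultimately have "matrix_eigenvalue ?A (of_real k)"
    unfolding matrix_eigenvalue_def by blast
  moreover have "skate_field m l g I1 I2 I3 differentiable (at (sliding_equilibrium Y0))"
    unfolding differentiable_def using D by blast
  ultimately show "linearly_unstable (skate_field m l g I1 I2 I3) (sliding_equilibrium Y0)"
    unfolding linearly_unstable_def using \<open>k > 0\<close> by (metis Re_complex_of_real)
qed

end
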